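(* Let $n\ge1$, $S_1\in\{\{b,g\},\{b,s\},\{y,o\},\{g,s\}\}$ and $S_2\in\{\{r,y\},\{r,g\},\{y,g\},\{b,o\}\}$. Then \[|J(T_n(S_1))|=|J(T_n(S_2))|=\prod_{j=1}^{n}C_j=\prod_{j=1}^{n}\frac{1}{j+1}\binom{2j}{j}=\prod_{1\le i\le j\le k\le n-1}\frac{i+j+2}{i+j},\] where $C_j$ is the $j$th Catalan number, and \[F(J(T_n(S_1)),q)=F(J(T_n(S_2)^* ),q)=\prod_{j=1}^{n}C_j(q),\] where $C_j(q)$ are the Carlitz–Riordan $q$-Catalan numbers defined by $C_0(q)=C_1(q)=1$ and $C_m(q)=\sum_{k=1}^{m}q^{k-1}C_{k-1}(q)C_{m-k}(q)$ for $m\ge2$.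
   Context: For an integer $n\ge1$, let $T_n$ be the set of triples $(c_1,c_2,c_3)$ of nonnegative integers with $c_1+c_2+c_3\le n-2$. Six colors are associated to vectors: red $r=(1,0,0)$, green $g=(0,1,0)$, yellow $y=(0,0,1)$, blue $b=(-1,1,0)$, orange $o=(-1,0,1)$, silver $s=(0,1,-1)$. For $S\subseteq\{r,b,g,o,y,s\}$, $T_n(S)$ is the poset on $T_n$ whose order relation is the reflexive–transitive closure of the relations $u<u+v$ for all $u,u+v\in T_n$ and $v$ the vector of a color in $S$. For a poset $P$, $P^*$ is its dual, $J(P)$ the set of order ideals of $P$, and $F(J(P),q)=\sum_{I\in J(P)}q^{|I|}$. *)

theory Defs
  imports
    "HOL-Library.Product_Plus"
    "HOL-Computational_Algebra.Polynomial"
begin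

text \<open>
  Posets are represented, as in \<^theory>\<open>HOL.Order_Relation\<close>, by their order relation, the pair
  \<open>(u, v)\<close> standing for \<open>u \<le> v\<close>; the underlying set is the \<^const>\<open>Field\<close> of the relation and the
  dual poset is the converse relation.
\<close>

datatype color = Red | Green | Yellow | Blue | Orange | Silver

fun color_vec :: "color \<Rightarrow> int \<times> int \<times> int" where
  "color_vec Red    = (1, 0, 0)"
| "color_vec Green  = (0, 1, 0)"
| "color_vec Yellow = (0, 0, 1)"
| "color_vec Blue   = (-1, 1, 0)"
| "color_vec Orange = (-1, 0, 1)"
| "color_vec Silver = (0, 1, -1)"

definition tetra :: "nat \<Rightarrow> (int \<times> int \<times> int) set" where
  "tetra n = {(c1, c2, c3). 0 \<le> c1 \<and> 0 \<le> c2 \<and> 0 \<le> c3 \<and> c1 + c2 + c3 \<le> int n - 2}"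

definition tetra_step :: "nat \<Rightarrow> color set \<Rightarrow> (int \<times> int \<times> int) rel" where
  "tetra_step n S =
     {(u, w). u \<in> tetra n \<and> w \<in> tetra n \<and> (\<exists>c\<in>S. w = u + color_vec c)}"

text \<open>The operator \<open>\<^sup>*\<close> is reflexive on the whole type, so its result is restricted to the carrier.\<close>

definition tetra_poset :: "nat \<Rightarrow> color set \<Rightarrow> (int \<times> int \<times> int) rel" where
  "tetra_poset n S = (tetra_step n S)\<^sup>* \<inter> (tetra n \<times> tetra n)"

lemma Field_tetra_poset: "Field (tetra_poset n S) = tetra n"
  by (auto simp: tetra_poset_def Field_def)

text \<open>
  Every color vector strictly increases \<open>c1 + 3 * c2 + 2 * c3\<close>, so the closure is antisymmetric
  for every set of colors.
\<close>

lemma partial_order_on_tetra_poset: "partial_order_on (tetra n) (tetra_poset n S)"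
proof -
  define h :: "int \<times> int \<times> int \<Rightarrow> int" where "h = (\<lambda>(a, b, c). a + 3 * b + 2 * c)"
  have step: "h u < h w" if "(u, w) \<in> tetra_step n S" for u w
  proof -
    obtain c where "w = u + color_vec c"
      using \<open>(u, w) \<in> tetra_step n S\<close> by (auto simp: tetra_step_def)
    then show ?thesis
      by (cases c; cases u) (auto simp: h_def)
  qed
  have less: "h u < h w" if "(u, w) \<in> (tetra_step n S)\<^sup>+" for u w
    using that by induction (auto dest: step)
  have "antisym ((tetra_step n S)\<^sup>*)"
    by (rule antisymI) (metis less less_asym rtranclD)
  then have "antisym (tetra_poset n S)"
    unfolding tetra_poset_def by (rule antisym_subset[rotated]) auto
  moreover have "trans (tetra_poset n S)"
    unfolding tetra_poset_def by (auto intro!: transI)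
  moreover have "refl_on (tetra n) (tetra_poset n S)"
    by (auto simp: tetra_poset_def refl_on_def)
  ultimately show ?thesis
    by (auto simp: partial_order_on_def preorder_on_def tetra_poset_def)
qed

text \<open>
  Despite its name, \<^const>\<open>Order_Relation.ofilter\<close> is the predicate of being a downward closed
  subset of the field, that is, an order ideal.
\<close>

definition order_ideals :: "'a rel \<Rightarrow> 'a set set" where
  "order_ideals r = {I. Order_Relation.ofilter r I}"

definition ideal_gf :: "'a rel \<Rightarrow> int poly" where
  "ideal_gf r = (\<Sum>I\<in>order_ideals r. monom 1 (card I))"

fun catalan :: "nat \<Rightarrow> nat" where
  "catalan 0 = 1"
| "catalan (Suc n) = (\<Sum>k\<le>n. catalan k * catalan (n - k))"

fun carlitz_riordan :: "nat \<Rightarrow> int poly" where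
  "carlitz_riordan 0 = 1"
| "carlitz_riordan (Suc 0) = 1"
| "carlitz_riordan (Suc (Suc m)) =
     (\<Sum>k = 1..m + 2. monom 1 (k - 1) * carlitz_riordan (k - 1) * carlitz_riordan (m + 2 - k))"

end

theory Submission
  imports Defs "HOL-Computational_Algebra.Formal_Power_Series"
begin

text \<open>
  For two colors the poset splits into triangular layers, and an affine symmetry of the tetrahedron
  turns every \<open>S\<^sub>1\<close>, and the reverse of every \<open>S\<^sub>2\<close>, into the pair blue, green. The layers are then
  root posets of type \<open>A\<close>. An ideal of a root poset that contains the first \<open>j\<close> minimal elements but
  not the next one avoids everything above that element; what remains is an ideal of the root poset
  of rank \<open>j - 1\<close> on top of the \<open>j\<close> minimal elements, and an ideal of the root poset to the right of
  the missing element. This is the Carlitz-Riordan recurrence.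
\<close>

section \<open>Ideals of a set with generating relations\<close>

text \<open>Only the pairs of \<open>R\<close> inside \<open>X\<close> constrain \<open>I\<close>,
  so one ambient generating relation serves a set and all its pieces.\<close>

definition closed_subsets :: "'a set \<Rightarrow> 'a rel \<Rightarrow> 'a set set" where
  "closed_subsets X R = {I. I \<subseteq> X \<and> (\<forall>u\<in>X. \<forall>w\<in>I. (u, w) \<in> R \<longrightarrow> u \<in> I)}"

definition closed_gf :: "'a set \<Rightarrow> 'a rel \<Rightarrow> int poly" where
  "closed_gf X R = (\<Sum>I\<in>closed_subsets X R. monom 1 (card I))"

lemma closed_subsetsD:
  "I \<in> closed_subsets X R \<Longrightarrow> (u, w) \<in> R \<Longrightarrow> w \<in> I \<Longrightarrow> u \<in> X \<Longrightarrow> u \<in> I"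
  by (auto simp: closed_subsets_def)

lemma finite_closed_subsets: "finite X \<Longrightarrow> finite (closed_subsets X R)"
  by (rule finite_subset[of _ "Pow X"]) (auto simp: closed_subsets_def)

lemma finite_mem_closed_subsets: "finite X \<Longrightarrow> I \<in> closed_subsets X R \<Longrightarrow> finite I"
  by (rule finite_subset[of _ X]) (auto simp: closed_subsets_def)

text \<open>Closure under single generating steps propagates down a chain by induction. Restricting
  to \<open>X\<close> before taking the closure keeps every chain inside \<open>X\<close>.\<close>

lemma order_ideals_rtrancl:
  assumes "E = R \<inter> X \<times> X"
  shows "order_ideals (E\<^sup>* \<inter> X \<times> X) = closed_subsets X R"
proof -
  have field: "Field (E\<^sup>* \<inter> X \<times> X) = X"
    by (auto simp: Field_def)
  have "u \<in> I" if "I \<in> closed_subsets X R" "w \<in> I" "(u, w) \<in> E\<^sup>*" for I u w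
    using that(3,2) by (induction rule: converse_rtrancl_induct)
      (use that(1) assms in \<open>auto simp: closed_subsets_def\<close>)
  moreover have "I \<subseteq> X" if "I \<in> closed_subsets X R" for I
    using that by (auto simp: closed_subsets_def)
  moreover have "(u, w) \<in> E\<^sup>* \<inter> X \<times> X" if "(u, w) \<in> R" "u \<in> X" "w \<in> X" for u w
    using that assms by auto
  then have "I \<in> closed_subsets X R"
    if "I \<subseteq> X" "\<forall>w\<in>I. {u. (u, w) \<in> E\<^sup>* \<inter> X \<times> X} \<subseteq> I" for I
    using that unfolding closed_subsets_def by blast
  ultimately show ?thesis
    unfolding order_ideals_def Order_Relation.ofilter_def under_def field by blast
qed

lemma closed_subsets_converse:
  "closed_subsets X (R\<inverse>) = (\<lambda>I. X - I) ` closed_subsets X R"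
proof -
  have *: "X - I \<in> closed_subsets X (Q\<inverse>)" if "I \<in> closed_subsets X Q" for I Q
    using that by (auto simp: closed_subsets_def)
  have "I \<in> (\<lambda>I. X - I) ` closed_subsets X R" if "I \<in> closed_subsets X (R\<inverse>)" for I
  proof (rule image_eqI)
    show "X - I \<in> closed_subsets X R"
      using *[OF that] by simp
    show "I = X - (X - I)"
      using that by (auto simp: closed_subsets_def)
  qed
  with * show ?thesis
    by blast
qed

text \<open>Complementation is injective but changes sizes, so it transfers the number of ideals to
  the dual, not their generating function. This supplies the count for \<open>S2\<close>.\<close>

lemma card_closed_subsets_converse:
  "card (closed_subsets X (R\<inverse>)) = card (closed_subsets X R)"
  unfolding closed_subsets_converse
  by (rule card_image) (auto simp: inj_on_def closed_subsets_def)

lemma poly_closed_gf_1: "poly (closed_gf X R) 1 = int (card (closed_subsets X R))"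
  by (simp add: closed_gf_def poly_sum poly_monom)

lemma closed_gf_empty [simp]: "closed_gf {} R = 1"
proof -
  have "closed_subsets {} R = {{}}"
    by (auto simp: closed_subsets_def)
  then show ?thesis
    by (simp add: closed_gf_def)
qed

text \<open>Taking images matches the ideals and preserves their sizes. Translations of layers and
  symmetries of the tetrahedron enter through this invariance.\<close>

lemma closed_gf_image:
  assumes "inj_on f X"
    and "\<And>u w. u \<in> X \<Longrightarrow> w \<in> X \<Longrightarrow> (f u, f w) \<in> Q \<longleftrightarrow> (u, w) \<in> R"
  shows "closed_gf (f ` X) Q = closed_gf X R"
proof -
  have "closed_subsets (f ` X) Q = (`) f ` closed_subsets X R"
  proof (intro equalityI subsetI)
    fix J assume J: "J \<in> closed_subsets (f ` X) Q"
    then obtain I where I: "I \<subseteq> X" "J = f ` I"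
      by (auto simp: closed_subsets_def subset_image_iff)
    have "I \<in> closed_subsets X R"
      unfolding closed_subsets_def
    proof (intro CollectI conjI ballI impI I(1))
      fix u w assume "u \<in> X" "w \<in> I" "(u, w) \<in> R"
      then have "(f u, f w) \<in> Q"
        using assms(2) I(1) by auto
      then have "f u \<in> f ` I"
        using J I(2) \<open>u \<in> X\<close> \<open>w \<in> I\<close> unfolding closed_subsets_def by blast
      then show "u \<in> I"
        using assms(1) I(1) \<open>u \<in> X\<close> by (auto dest: inj_onD)
    qed
    with I show "J \<in> (`) f ` closed_subsets X R"
      by blast
  next
    fix J assume "J \<in> (`) f ` closed_subsets X R"
    then show "J \<in> closed_subsets (f ` X) Q"
      using assms(2) by (fastforce simp: closed_subsets_def)
  qed
  moreover have "inj_on ((`) f) (closed_subsets X R)"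
    by (rule inj_on_subset[OF inj_on_image_Pow[OF assms(1)]]) (auto simp: closed_subsets_def)
  moreover have "card (f ` I) = card I" if "I \<in> closed_subsets X R" for I
    using that assms(1) by (intro card_image) (auto simp: closed_subsets_def inj_on_def)
  ultimately show ?thesis
    unfolding closed_gf_def by (simp add: sum.reindex cong: sum.cong)
qed

text \<open>The traces of an ideal on \<open>X\<close> and on \<open>Y\<close> can be chosen
  independently, and their sizes add.\<close>

lemma closed_gf_Un:
  assumes fin: "finite X" "finite Y" and disj: "X \<inter> Y = {}"
    and no_edge: "R \<inter> X \<times> Y = {}" "R \<inter> Y \<times> X = {}"
  shows "closed_gf (X \<union> Y) R = closed_gf X R * closed_gf Y R"
proof -
  let ?f = "\<lambda>(A, B). A \<union> B"
  let ?P = "closed_subsets X R \<times> closed_subsets Y R"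
  have "closed_subsets (X \<union> Y) R = ?f ` ?P"
  proof (intro equalityI subsetI)
    fix I assume I: "I \<in> closed_subsets (X \<union> Y) R"
    then have "I = ?f (I \<inter> X, I \<inter> Y)" "(I \<inter> X, I \<inter> Y) \<in> ?P"
      by (auto simp: closed_subsets_def)
    then show "I \<in> ?f ` ?P"
      by (rule image_eqI)
  next
    fix I assume "I \<in> ?f ` ?P"
    then obtain A B where AB: "A \<in> closed_subsets X R" "B \<in> closed_subsets Y R" "I = A \<union> B"
      by auto
    with no_edge have "u \<in> I" if "u \<in> X \<union> Y" "w \<in> I" "(u, w) \<in> R" for u w
      using that unfolding closed_subsets_def by blast
    with AB show "I \<in> closed_subsets (X \<union> Y) R"
      by (auto simp: closed_subsets_def)
  qed
  moreover have "inj_on ?f ?P"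
  proof (rule inj_on_inverseI)
    fix p assume "p \<in> ?P"
    then obtain A B where "p = (A, B)" "A \<subseteq> X" "B \<subseteq> Y"
      by (auto simp: closed_subsets_def)
    moreover from this disj have "(A \<union> B) \<inter> X = A" "(A \<union> B) \<inter> Y = B"
      by blast+
    ultimately show "(?f p \<inter> X, ?f p \<inter> Y) = p"
      by simp
  qed
  moreover have "card (A \<union> B) = card A + card B"
    if "A \<in> closed_subsets X R" "B \<in> closed_subsets Y R" for A B
  proof (rule card_Un_disjoint)
    show "finite A" "finite B"
      using that fin by (auto intro: finite_mem_closed_subsets)
    show "A \<inter> B = {}"
      using that disj by (auto simp: closed_subsets_def)
  qed
  ultimately have "closed_gf (X \<union> Y) R = (\<Sum>(A, B)\<in>?P. monom 1 (card A + card B))"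
    unfolding closed_gf_def by (simp add: sum.reindex case_prod_unfold mem_Times_iff)
  also have "\<dots> = closed_gf X R * closed_gf Y R"
    by (simp add: closed_gf_def sum_product sum.cartesian_product mult_monom)
  finally show ?thesis .
qed

section \<open>The root poset of type A\<close>

text \<open>The point \<open>(a, b)\<close> encodes the interval from \<open>a\<close> to
  \<open>a + b\<close> in \<open>{0..<m}\<close>, that is, a sum of consecutive simple roots of
  \<open>A_m\<close>.\<close>

definition triangle :: "nat \<Rightarrow> (int \<times> int) set" where
  "triangle m = {(a, b). 0 \<le> a \<and> 0 \<le> b \<and> a + b < int m}"

text \<open>An interval is covered by its extensions by one point, to the right
  (\<open>a' = a\<close>) or to the left (\<open>a' = a - 1\<close>).\<close>

definition triangle_rel :: "(int \<times> int) rel" where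
  "triangle_rel = {((a, b), (a', b')). b' = b + 1 \<and> (a' = a \<or> a' = a - 1)}"

lemma finite_triangle [simp]: "finite (triangle m)"
  by (rule finite_subset[of _ "{0..int m} \<times> {0..int m}"]) (auto simp: triangle_def)

lemma triangle_0 [simp]: "triangle 0 = {}"
  by (auto simp: triangle_def)

text \<open>Dropping an endpoint of an interval is a step down, and repeating this reaches every
  single point of the interval. Hence a missing minimal element excludes everything above
  it.\<close>

lemma closed_subsets_triangle_bottom:
  assumes I: "I \<in> closed_subsets (triangle m) triangle_rel"
    and "(a, b) \<in> I" "a \<le> c" "c \<le> a + b"
  shows "(c, 0) \<in> I"
  using assms(2-)
proof (induction "nat b" arbitrary: a b)
  case 0
  with I have "b = 0"
    by (auto simp: closed_subsets_def triangle_def)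
  with 0 show ?case
    by auto
next
  case (Suc k)
  then have "k = nat (b - 1)" and ab: "0 \<le> a" "b > 0" "a + b < int m"
    using I by (auto simp: closed_subsets_def triangle_def)
  have down: "(a, b - 1) \<in> I" "(a + 1, b - 1) \<in> I"
    by (rule closed_subsetsD[OF I _ Suc.prems(1)];
      use Suc.prems ab in \<open>simp add: triangle_def triangle_rel_def\<close>)+
  show ?case
  \<comment> \<open>The lower neighbor \<open>(a, b - 1)\<close> handles every \<open>c\<close> but
    the right endpoint, which only \<open>(a + 1, b - 1)\<close> retains.\<close>
  proof (cases "c = a + b")
    case True
    then show ?thesis
      using Suc.hyps(1)[OF \<open>k = nat (b - 1)\<close> down(2)] ab by simp
  next
    case False
    then show ?thesis
      using Suc.hyps(1)[OF \<open>k = nat (b - 1)\<close> down(1)] Suc.prems by simp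
  qed
qed

section \<open>Splitting ideals by their first missing minimal element\<close>

definition bottom_row :: "nat \<Rightarrow> (int \<times> int) set" where
  "bottom_row j = (\<lambda>i. (int i, 0)) ` {..<j}"

text \<open>For \<open>j = m\<close> the gap lies just outside the triangle, so this class holds the
  ideals that contain all minimal elements.\<close>

definition first_gap :: "nat \<Rightarrow> nat \<Rightarrow> (int \<times> int) set set" where
  "first_gap m j = {I \<in> closed_subsets (triangle m) triangle_rel. bottom_row j \<subseteq> I \<and> (int j, 0) \<notin> I}"

text \<open>These are the intervals with at least two points, all to the left of \<open>j\<close>;
  truncated subtraction gives the empty set for \<open>j = 0\<close>.\<close>

definition upper_part :: "nat \<Rightarrow> (int \<times> int) set" where
  "upper_part j = (\<lambda>(a, b). (a, b + 1)) ` triangle (j - 1)"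

definition right_part :: "nat \<Rightarrow> nat \<Rightarrow> (int \<times> int) set" where
  "right_part m j = (\<lambda>(a, b). (a + int j + 1, b)) ` triangle (m - j - 1)"

lemma mem_bottom_row: "(a, b) \<in> bottom_row j \<longleftrightarrow> 0 \<le> a \<and> a < int j \<and> b = 0"
  unfolding bottom_row_def by (auto intro!: image_eqI[of _ _ "nat a"])

lemma mem_upper_part: "(a, b) \<in> upper_part j \<longleftrightarrow> 0 \<le> a \<and> 1 \<le> b \<and> a + b < int j"
  unfolding upper_part_def triangle_def
  by (auto intro!: image_eqI[of _ _ "(a, b - 1)"])

lemma mem_right_part: "(a, b) \<in> right_part m j \<longleftrightarrow> int j < a \<and> 0 \<le> b \<and> a + b < int m"
  unfolding right_part_def triangle_def
  by (auto intro!: image_eqI[of _ _ "(a - int j - 1, b)"])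

lemmas mem_parts = mem_bottom_row mem_upper_part mem_right_part

context
  fixes m j :: nat
  assumes jm: "j \<le> m"
begin

lemma bottom_row_subset: "bottom_row j \<subseteq> triangle m - {(int j, 0)}"
  using jm by (auto simp: mem_parts triangle_def)

lemma parts_subset: "upper_part j \<union> right_part m j \<subseteq> triangle m - bottom_row j - {(int j, 0)}"
  using jm by (auto simp: mem_parts triangle_def)

text \<open>No interval of the ideal may contain \<open>j\<close>, so each lies to the left or to
  the right of \<open>j\<close>. The single points on the left are forced, and the rest is an
  arbitrary ideal of the two parts.\<close>

lemma first_gap_eq:
  "first_gap m j = (\<lambda>K. bottom_row j \<union> K) ` closed_subsets (upper_part j \<union> right_part m j) triangle_rel"
proof (intro equalityI subsetI)
  fix I assume "I \<in> first_gap m j"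
  then have I: "I \<in> closed_subsets (triangle m) triangle_rel" "bottom_row j \<subseteq> I" "(int j, 0) \<notin> I"
    by (auto simp: first_gap_def)
  then have sub: "I \<subseteq> triangle m"
    by (auto simp: closed_subsets_def)
  have sub': "I - bottom_row j \<subseteq> upper_part j \<union> right_part m j"
  proof clarify
    fix a b assume ab: "(a, b) \<in> I" "(a, b) \<notin> bottom_row j" "(a, b) \<notin> right_part m j"
    with sub have "a \<le> int j" "0 \<le> a" "0 \<le> b"
      by (auto simp: mem_parts triangle_def)
    with closed_subsets_triangle_bottom[OF I(1) ab(1), of "int j"] I(3) have "a + b < int j"
      by force
    with ab \<open>0 \<le> a\<close> \<open>0 \<le> b\<close> show "(a, b) \<in> upper_part j"
      by (auto simp: mem_parts)
  qed
  with I(1) parts_subset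
  have "I - bottom_row j \<in> closed_subsets (upper_part j \<union> right_part m j) triangle_rel"
    unfolding closed_subsets_def by blast
  with I(2) show "I \<in> (\<lambda>K. bottom_row j \<union> K) ` closed_subsets (upper_part j \<union> right_part m j) triangle_rel"
    by (intro image_eqI[of _ _ "I - bottom_row j"]) auto
next
  fix I assume "I \<in> (\<lambda>K. bottom_row j \<union> K) ` closed_subsets (upper_part j \<union> right_part m j) triangle_rel"
  then obtain K where K: "K \<in> closed_subsets (upper_part j \<union> right_part m j) triangle_rel"
    and I: "I = bottom_row j \<union> K"
    by blast
  have sub: "K \<subseteq> upper_part j \<union> right_part m j"
    using K by (auto simp: closed_subsets_def)
  have "u \<in> I" if u: "u \<in> triangle m" "w \<in> I" "(u, w) \<in> triangle_rel" for u w
  proof (cases "u \<in> bottom_row j")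
    case False
    \<comment> \<open>A point with a predecessor in the triangle has positive second
      coordinate.\<close>
    have "w \<notin> bottom_row j"
      using u(1,3) by (auto simp: mem_parts triangle_rel_def triangle_def)
    then have "w \<in> K"
      using u(2) I by blast
    \<comment> \<open>Shrinking an interval keeps it on its side of \<open>j\<close>; it could leave
      the two parts only by landing in \<open>bottom_row j\<close>, which \<open>False\<close>
      excludes.\<close>
    moreover from this sub u False have "u \<in> upper_part j \<union> right_part m j"
      by (cases u; cases w) (auto simp: mem_parts triangle_rel_def triangle_def)
    ultimately have "u \<in> K"
      using K u(3) by (auto simp: closed_subsets_def)
    then show ?thesis
      using I by blast
  qed (use I in blast)
  moreover have "I \<subseteq> triangle m" "(int j, 0) \<notin> I"
    using sub I bottom_row_subset parts_subset by blast+
  ultimately show "I \<in> first_gap m j"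
    using I by (auto simp: first_gap_def closed_subsets_def)
qed

text \<open>The forced bottom row contributes \<open>monom 1 j\<close>. The two remaining parts are
  separated by \<open>j\<close>, so no relation joins them and their generating functions
  multiply.\<close>

lemma sum_first_gap:
  "(\<Sum>I\<in>first_gap m j. monom 1 (card I)) =
     monom 1 j * closed_gf (triangle (j - 1)) triangle_rel
               * closed_gf (triangle (m - j - 1)) triangle_rel"
proof -
  let ?K = "closed_subsets (upper_part j \<union> right_part m j) triangle_rel"
  have fin: "finite (upper_part j)" "finite (right_part m j)" "finite (bottom_row j)"
    by (auto simp: upper_part_def right_part_def bottom_row_def)
  have card_bottom: "card (bottom_row j) = j"
    unfolding bottom_row_def by (subst card_image) (auto simp: inj_on_def)
  have disj: "K \<inter> bottom_row j = {}" if "K \<in> ?K" for K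
    using that parts_subset by (auto simp: closed_subsets_def)
  have "inj_on (\<lambda>K. bottom_row j \<union> K) ?K"
    using disj by (intro inj_onI) blast
  moreover have "card (bottom_row j \<union> K) = j + card K" if "K \<in> ?K" for K
    using disj[OF that] fin finite_mem_closed_subsets[OF finite_UnI[OF fin(1,2)] that]
    by (subst card_Un_disjoint) (auto simp: card_bottom)
  ultimately have "(\<Sum>I\<in>first_gap m j. monom 1 (card I)) = (\<Sum>K\<in>?K. monom (1::int) (j + card K))"
    by (simp add: first_gap_eq sum.reindex)
  also have "\<dots> = monom 1 j * closed_gf (upper_part j \<union> right_part m j) triangle_rel"
    by (simp add: closed_gf_def sum_distrib_left mult_monom)
  also have "closed_gf (upper_part j \<union> right_part m j) triangle_rel
      = closed_gf (upper_part j) triangle_rel * closed_gf (right_part m j) triangle_rel"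
    by (rule closed_gf_Un) (use fin in \<open>auto simp: mem_parts triangle_rel_def\<close>)
  also have "closed_gf (upper_part j) triangle_rel = closed_gf (triangle (j - 1)) triangle_rel"
    unfolding upper_part_def by (rule closed_gf_image) (auto simp: inj_on_def triangle_rel_def)
  also have "closed_gf (right_part m j) triangle_rel = closed_gf (triangle (m - j - 1)) triangle_rel"
    unfolding right_part_def by (rule closed_gf_image) (auto simp: inj_on_def triangle_rel_def)
  finally show ?thesis
    by (simp add: mult.assoc)
qed

end

lemma closed_subsets_triangle_eq_UN_first_gap:
  "closed_subsets (triangle m) triangle_rel = (\<Union>j\<le>m. first_gap m j)"
proof (intro equalityI subsetI)
  fix I assume I: "I \<in> closed_subsets (triangle m) triangle_rel"
  define j where "j = (LEAST j. (int j, 0) \<notin> I)"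
  \<comment> \<open>This witness, outside the triangle, shows that the least gap exists and is at
    most \<open>m\<close>.\<close>
  have m: "(int m, 0) \<notin> I"
    using I by (auto simp: closed_subsets_def triangle_def)
  have "(int j, 0) \<notin> I" "j \<le> m"
    using m unfolding j_def by (rule LeastI, rule Least_le)
  moreover have "(int i, 0) \<in> I" if "i < j" for i
    using not_less_Least[OF that[unfolded j_def]] by simp
  then have "bottom_row j \<subseteq> I"
    by (auto simp: bottom_row_def)
  ultimately show "I \<in> (\<Union>j\<le>m. first_gap m j)"
    using I by (auto simp: first_gap_def)
qed (auto simp: first_gap_def)

lemma disjoint_first_gap:
  assumes "i \<noteq> j"
  shows "first_gap m i \<inter> first_gap m j = {}"
proof -
  have "first_gap m i \<inter> first_gap m j = {}" if "i < j" for i j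
    using that by (force simp: first_gap_def bottom_row_def)
  with assms show ?thesis
    by (metis inf_commute linorder_neqE_nat)
qed

lemma closed_gf_triangle_rec:
  "closed_gf (triangle m) triangle_rel =
     (\<Sum>j\<le>m. monom 1 j * closed_gf (triangle (j - 1)) triangle_rel
                         * closed_gf (triangle (m - j - 1)) triangle_rel)"
proof -
  have "finite (first_gap m j)" for j
    by (rule finite_subset[OF _ finite_closed_subsets[of "triangle m" triangle_rel]])
      (auto simp: first_gap_def)
  then have "closed_gf (triangle m) triangle_rel = (\<Sum>j\<le>m. \<Sum>I\<in>first_gap m j. monom 1 (card I))"
    unfolding closed_gf_def closed_subsets_triangle_eq_UN_first_gap
    by (intro sum.UNION_disjoint) (simp_all add: disjoint_first_gap)
  then show ?thesis
    by (simp add: sum_first_gap)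
qed

text \<open>The substitution \<open>k = j + 1\<close> and the absorption of the separate value at
  \<open>1\<close> give the exact shape of the sum over first gaps.\<close>

lemma carlitz_riordan_Suc:
  "carlitz_riordan (Suc m) = (\<Sum>j\<le>m. monom 1 j * carlitz_riordan j * carlitz_riordan (m - j))"
proof (cases m)
  case (Suc l)
  have "carlitz_riordan (Suc m) =
      (\<Sum>k = Suc 0..Suc m. monom 1 (k - 1) * carlitz_riordan (k - 1) * carlitz_riordan (Suc m - k))"
    by (simp add: Suc)
  also have "\<dots> = (\<Sum>j = 0..m. monom 1 j * carlitz_riordan j * carlitz_riordan (m - j))"
    by (subst sum.shift_bounds_cl_Suc_ivl) simp
  finally show ?thesis
    by (simp add: atLeast0AtMost)
qed simp

text \<open>Truncated subtraction makes \<open>k = 0\<close> and \<open>k = 1\<close> both give the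
  empty triangle, in agreement with the two initial values. The boundary summands
  \<open>j = 0\<close> and \<open>j = m\<close> therefore fit the recurrence.\<close>

lemma closed_gf_triangle: "closed_gf (triangle (k - 1)) triangle_rel = carlitz_riordan k"
proof (induction k rule: less_induct)
  case (less k)
  show ?case
  proof (cases k)
    case (Suc m)
    then have "closed_gf (triangle (j - 1)) triangle_rel = carlitz_riordan j"
      "closed_gf (triangle (m - j - 1)) triangle_rel = carlitz_riordan (m - j)" if "j \<le> m" for j
      using less[of j] less[of "m - j"] that by auto
    then have "closed_gf (triangle m) triangle_rel =
        (\<Sum>j\<le>m. monom 1 j * carlitz_riordan j * carlitz_riordan (m - j))"
      unfolding closed_gf_triangle_rec[of m]
      by (intro sum.cong refl) (simp only: atMost_iff)
    then show ?thesis
      by (simp only: Suc carlitz_riordan_Suc diff_Suc_1)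
  qed simp
qed

section \<open>The tetrahedron\<close>

text \<open>Without the restriction to \<open>tetra n\<close> the relation depends only on
  differences, so it is invariant under translations and common to all sizes.\<close>

definition color_rel :: "color set \<Rightarrow> (int \<times> int \<times> int) rel" where
  "color_rel S = {(u, w). \<exists>c\<in>S. w = u + color_vec c}"

lemma finite_tetra [simp]: "finite (tetra n)"
  by (rule finite_subset[of _ "{0..int n} \<times> {0..int n} \<times> {0..int n}"]) (auto simp: tetra_def)

text \<open>Blue and green fix \<open>c3\<close>, so layers do not interact. The layer
  \<open>c3 = 0\<close> of \<open>tetra (Suc n)\<close> is \<open>triangle n\<close>, and the other
  layers form a translate of \<open>tetra n\<close>.\<close>

lemma closed_gf_tetra:
  "closed_gf (tetra n) (color_rel {Blue, Green}) = (\<Prod>j = 1..n. carlitz_riordan j)"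
proof (induction n)
  case 0
  have "tetra 0 = {}"
    by (auto simp: tetra_def)
  then show ?case
    by simp
next
  case (Suc n)
  let ?R = "color_rel {Blue, Green}"
  define X where "X = (\<lambda>(a, b). (a, b, 0::int)) ` triangle n"
  define Y where "Y = (\<lambda>(a, b, c). (a, b, c + 1::int)) ` tetra n"
  have "u \<in> X \<union> Y" if "u \<in> tetra (Suc n)" for u
  proof -
    obtain a b c where u: "u = (a, b, c)"
      by (cases u)
    show ?thesis
    proof (cases "c = 0")
      case True
      with that u have "u \<in> X"
        by (auto simp: X_def tetra_def triangle_def)
      then show ?thesis ..
    next
      case False
      with that u have "u \<in> Y"
        unfolding Y_def by (intro image_eqI[of _ _ "(a, b, c - 1)"]) (auto simp: tetra_def)
      then show ?thesis ..
    qed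
  qed
  moreover have "X \<union> Y \<subseteq> tetra (Suc n)"
    by (auto simp: X_def Y_def tetra_def triangle_def)
  ultimately have "tetra (Suc n) = X \<union> Y"
    by blast
  moreover have "finite X" "finite Y"
    by (simp_all add: X_def Y_def)
  then have "closed_gf (X \<union> Y) ?R = closed_gf X ?R * closed_gf Y ?R"
    by (rule closed_gf_Un) (auto simp: X_def Y_def color_rel_def tetra_def)
  moreover have "closed_gf X ?R = carlitz_riordan (Suc n)"
    unfolding X_def closed_gf_triangle[of "Suc n", symmetric] diff_Suc_1
    by (rule closed_gf_image) (auto simp: inj_on_def color_rel_def triangle_rel_def)
  moreover have "closed_gf Y ?R = closed_gf (tetra n) ?R"
    unfolding Y_def by (rule closed_gf_image) (auto simp: inj_on_def color_rel_def)
  ultimately show ?case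
    by (simp add: Suc.IH)
qed

lemma order_ideals_tetra_poset:
  "order_ideals (tetra_poset n S) = closed_subsets (tetra n) (color_rel S)"
  unfolding tetra_poset_def
  by (rule order_ideals_rtrancl) (auto simp: tetra_step_def color_rel_def)

lemma order_ideals_tetra_poset_converse:
  "order_ideals ((tetra_poset n S)\<inverse>) = closed_subsets (tetra n) ((color_rel S)\<inverse>)"
proof -
  have "(tetra_poset n S)\<inverse> = ((tetra_step n S)\<inverse>)\<^sup>* \<inter> tetra n \<times> tetra n"
    by (auto simp: tetra_poset_def rtrancl_converse)
  moreover have "(tetra_step n S)\<inverse> = (color_rel S)\<inverse> \<inter> tetra n \<times> tetra n"
    by (auto simp: tetra_step_def color_rel_def)
  ultimately show ?thesis
    by (simp only: order_ideals_rtrancl)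
qed

section \<open>Symmetries permuting the barycentric coordinates\<close>

lemma closed_gf_tetra_transfer:
  assumes inj: "inj_on f (tetra n)" and into: "f ` tetra n \<subseteq> tetra n"
    and rel: "\<And>u w. (f u, f w) \<in> color_rel {Blue, Green} \<longleftrightarrow> (u, w) \<in> R"
  shows "closed_gf (tetra n) R = (\<Prod>j = 1..n. carlitz_riordan j)"
proof -
  have "f ` tetra n = tetra n"
    using endo_inj_surj[OF finite_tetra into inj] .
  with closed_gf_image[OF inj rel] show ?thesis
    by (simp add: closed_gf_tetra)
qed

text \<open>With the slack \<open>c4 = n - 2 - c1 - c2 - c3\<close>, every color moves one unit
  between two of four coordinates. Both colors of \<open>S\<close> raise the same coordinate. The
  maps put it second, the coordinate untouched by both third, and the two lowered ones first and
  into the slack, which yields blue and green.\<close>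

lemma closed_gf_tetra_S1:
  assumes "S \<in> {{Blue, Green}, {Blue, Silver}, {Yellow, Orange}, {Green, Silver}}"
  shows "closed_gf (tetra n) (color_rel S) = (\<Prod>j = 1..n. carlitz_riordan j)"
proof -
  note [simp] = inj_on_def tetra_def color_rel_def
  consider "S = {Blue, Green}" | "S = {Blue, Silver}" | "S = {Yellow, Orange}" | "S = {Green, Silver}"
    using assms by auto
  then show ?thesis
  proof cases
    case 1
    then show ?thesis
      by (simp only: closed_gf_tetra)
  next
    case 2
    show ?thesis
      by (rule closed_gf_tetra_transfer[of "\<lambda>(c1, c2, c3). (c1, c2, int n - 2 - c1 - c2 - c3)"])
        (use 2 in auto)
  next
    case 3
    show ?thesis
      by (rule closed_gf_tetra_transfer[of "\<lambda>(c1, c2, c3). (c1, c3, c2)"]) (use 3 in auto)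
  next
    case 4
    show ?thesis
      by (rule closed_gf_tetra_transfer[of "\<lambda>(c1, c2, c3). (c3, c2, c1)"]) (use 4 in auto)
  qed
qed

text \<open>Here both colors lower the same coordinate, the slack or \<open>c1\<close>. Reversed,
  they raise it, and a coordinate permutation again yields blue and green.\<close>

lemma closed_gf_tetra_S2:
  assumes "S \<in> {{Red, Yellow}, {Red, Green}, {Yellow, Green}, {Blue, Orange}}"
  shows "closed_gf (tetra n) ((color_rel S)\<inverse>) = (\<Prod>j = 1..n. carlitz_riordan j)"
proof -
  note [simp] = inj_on_def tetra_def color_rel_def
  consider "S = {Red, Yellow}" | "S = {Red, Green}" | "S = {Yellow, Green}" | "S = {Blue, Orange}"
    using assms by auto
  then show ?thesis
  proof cases
    case 1
    show ?thesis
      by (rule closed_gf_tetra_transfer[of "\<lambda>(c1, c2, c3). (c1, int n - 2 - c1 - c2 - c3, c2)"])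
        (use 1 in auto)
  next
    case 2
    show ?thesis
      by (rule closed_gf_tetra_transfer[of "\<lambda>(c1, c2, c3). (c1, int n - 2 - c1 - c2 - c3, c3)"])
        (use 2 in auto)
  next
    case 3
    show ?thesis
      by (rule closed_gf_tetra_transfer[of "\<lambda>(c1, c2, c3). (c2, int n - 2 - c1 - c2 - c3, c1)"])
        (use 3 in auto)
  next
    case 4
    show ?thesis
      by (rule closed_gf_tetra_transfer[of "\<lambda>(c1, c2, c3). (c2, c1, int n - 2 - c1 - c2 - c3)"])
        (use 4 in auto)
  qed
qed

section \<open>Catalan numbers\<close>

lemma poly_carlitz_riordan_1: "poly (carlitz_riordan m) 1 = int (catalan m)"
proof (induction m rule: less_induct)
  case (less m)
  show ?case
  proof (cases m)
    case (Suc l)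
    then show ?thesis
      using less by (simp add: carlitz_riordan_Suc poly_sum poly_monom del: carlitz_riordan.simps)
  qed simp
qed

text \<open>
  The generating function \<open>F\<close> satisfies \<open>F = 1 + z F\<^sup>2\<close>, so \<open>G = 1 - 2 z F\<close> is a square root of
  \<open>1 - 4 z\<close>; differentiating gives \<open>(1 - 4 z) G' = - 2 G\<close>, which is the claimed recurrence.
\<close>

lemma catalan_Suc_mult:
  "(real m + 2) * real (catalan (Suc m)) = (4 * real m + 2) * real (catalan m)"
proof -
  define F :: "real fps" where "F = Abs_fps (\<lambda>k. real (catalan k))"
  define G where "G = 1 - 2 * (fps_X * F)"
  have F: "F = 1 + fps_X * (F * F)"
  proof (rule fps_ext)
    fix k
    have "fps_nth (F * F) l = real (catalan (Suc l))" for l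
      by (simp add: F_def fps_mult_nth atLeast0AtMost)
    then show "fps_nth F k = fps_nth (1 + fps_X * (F * F)) k"
      by (cases k) (simp_all add: F_def del: catalan.simps(2))
  qed
  have "G * G = 1 - 4 * (fps_X * F) + 4 * (fps_X * (fps_X * (F * F)))"
    by (simp add: G_def algebra_simps)
  also have "fps_X * (F * F) = F - 1"
    using F by (simp add: algebra_simps)
  finally have sq: "G * G = 1 - 4 * fps_X"
    by (simp add: algebra_simps)
  then have "fps_deriv (G * G) = fps_deriv (1 - 4 * fps_X)"
    by simp
  then have "2 * (G * fps_deriv G) = - 4"
    by (simp add: mult.commute)
  \<comment> \<open>Multiplying by \<open>G\<close> brings in the known square \<open>G * G\<close>
    and avoids dividing by a series.\<close>
  then have "G * (2 * (G * fps_deriv G)) = G * - 4"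
    by simp
  then have "2 * (G * G * fps_deriv G) = - 4 * G"
    by (simp add: algebra_simps)
  then have "2 * fps_deriv G - 8 * (fps_X * fps_deriv G) = - 4 * G"
    unfolding sq by (simp add: algebra_simps)
  \<comment> \<open>At index \<open>Suc m\<close> only coefficients of \<open>G\<close> with
    positive index occur, each \<open>- 2\<close> times a Catalan number.\<close>
  then have "fps_nth (2 * fps_deriv G - 8 * (fps_X * fps_deriv G)) (Suc m) = fps_nth (- 4 * G) (Suc m)"
    by simp
  moreover have "fps_nth G (Suc k) = - 2 * real (catalan k)" for k
    by (simp add: G_def F_def fps_numeral_fps_const)
  ultimately show ?thesis
    by (simp add: fps_numeral_fps_const algebra_simps del: catalan.simps)
qed

section \<open>Closed formulas for Catalan numbers and their products\<close>

lemma catalan_eq_binomial: "real (catalan j) = 1 / (real j + 1) * real ((2 * j) choose j)"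
proof (induction j)
  case (Suc j)
  \<comment> \<open>Two absorption identities give the ratio of consecutive central binomial
    coefficients, to be compared with \<open>catalan_Suc_mult\<close>.\<close>
  have "((2 * Suc j) choose Suc j) * Suc j = 2 * (Suc j * ((2 * j + 1) choose j))"
    using Suc_times_binomial_eq[of "2 * j + 1" j] by (simp del: binomial_Suc_Suc)
  also have "Suc j * ((2 * j + 1) choose j) = (2 * j + 1) * ((2 * j) choose j)"
    using binomial_absorb_comp[of "2 * j + 1" j] by (simp del: binomial_Suc_Suc)
  finally have "real (((2 * Suc j) choose Suc j) * Suc j) = real (2 * ((2 * j + 1) * ((2 * j) choose j)))"
    by (simp only:)
  then have "(real j + 1) * real ((2 * Suc j) choose Suc j) =
      2 * (2 * real j + 1) * real ((2 * j) choose j)"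
    by (simp only: of_nat_mult of_nat_add of_nat_Suc of_nat_1 of_nat_numeral) (simp only: algebra_simps)
  also have "real ((2 * j) choose j) = (real j + 1) * real (catalan j)"
    using Suc.IH by simp
  finally have "(real j + 1) * real ((2 * Suc j) choose Suc j) =
      (real j + 1) * ((4 * real j + 2) * real (catalan j))"
    by (simp only: algebra_simps)
  then have "real ((2 * Suc j) choose Suc j) = (4 * real j + 2) * real (catalan j)"
    by (subst (asm) mult_cancel_left) simp
  then show ?case
    using catalan_Suc_mult[of j] by (simp add: field_simps del: catalan.simps binomial_Suc_Suc mult_Suc_right)
qed simp

text \<open>Numerators cancel against denominators two places later, leaving the last two numerators
  and the first two denominators.\<close>

lemma prod_shift_2_telescope:
  fixes x :: real
  assumes "x \<ge> 0"
  shows "(\<Prod>i = 1..r. (real i + x + 2) / (real i + x)) =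
    (real r + x + 1) * (real r + x + 2) / ((x + 1) * (x + 2))"
proof (induction r)
  case 0
  with assms show ?case by simp
next
  case (Suc r)
  have "real r + x + 1 \<noteq> 0" "x + 1 \<noteq> 0" "x + 2 \<noteq> 0"
    using assms by linarith+
  then have step: "(real r + x + 1) * (real r + x + 2) / ((x + 1) * (x + 2)) *
      ((real r + x + 3) / (real r + x + 1)) =
      (real r + x + 2) * (real r + x + 3) / ((x + 1) * (x + 2))"
    by (simp add: divide_simps)
  have "(\<Prod>i = 1..Suc r. (real i + x + 2) / (real i + x)) =
      (\<Prod>i = 1..r. (real i + x + 2) / (real i + x)) * ((real r + x + 3) / (real r + x + 1))"
    by (simp add: add_ac)
  also have "\<dots> = (real r + x + 2) * (real r + x + 3) / ((x + 1) * (x + 2))"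
    unfolding Suc.IH by (rule step)
  finally show ?case
    by (simp add: add_ac)
qed

text \<open>Passing to \<open>Suc k\<close> adds the column \<open>j = Suc k\<close>, which
  telescopes to the ratio of consecutive Catalan numbers.\<close>

lemma catalan_eq_prod:
  "real (catalan (Suc k)) =
     (\<Prod>(i, j) \<in> {(i, j). 1 \<le> i \<and> i \<le> j \<and> j \<le> k}. (real i + real j + 2) / (real i + real j))"
proof (induction k)
  case 0
  have empty: "{(i, j). 1 \<le> i \<and> i \<le> j \<and> j \<le> (0::nat)} = {}"
    by auto
  show ?case
    unfolding empty by simp
next
  case (Suc k)
  let ?A = "\<lambda>k. {(i, j). 1 \<le> i \<and> i \<le> j \<and> j \<le> (k::nat)}"
  let ?B = "(\<lambda>i. (i, Suc k)) ` {1..Suc k}"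
  let ?f = "\<lambda>(i, j). (real i + real j + 2) / (real i + real j)"
  have "prod ?f (?A (Suc k)) = prod ?f (?A k) * prod ?f ?B"
  proof (subst prod.union_disjoint[symmetric])
    show "finite (?A k)"
      by (rule finite_subset[of _ "{..k} \<times> {..k}"]) auto
  qed (auto intro!: prod.cong)
  also have "prod ?f ?B = (\<Prod>i = 1..Suc k. (real i + real (Suc k) + 2) / (real i + real (Suc k)))"
    by (subst prod.reindex) (auto simp: inj_on_def)
  also have "\<dots> = (real (Suc k) + real (Suc k) + 1) * (real (Suc k) + real (Suc k) + 2)
      / ((real (Suc k) + 1) * (real (Suc k) + 2))"
    by (rule prod_shift_2_telescope) simp
  also have "\<dots> = (4 * real (Suc k) + 2) / (real (Suc k) + 2)"
    by (simp add: divide_simps) (simp add: algebra_simps)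
  also have "prod ?f (?A k) = real (catalan (Suc k))"
    using Suc.IH by simp
  also have "\<dots> * ((4 * real (Suc k) + 2) / (real (Suc k) + 2)) = real (catalan (Suc (Suc k)))"
    using catalan_Suc_mult[of "Suc k"] by (simp add: field_simps del: catalan.simps)
  finally show ?case
    by (rule sym)
qed

text \<open>The slice with fixed last index \<open>k\<close> contributes
  \<open>catalan (Suc k)\<close>; the factor \<open>catalan 1 = 1\<close> has no slice.\<close>

lemma prod_catalan_eq_prod:
  "real (\<Prod>j = 1..Suc m. catalan j) =
     (\<Prod>(i, j, k) \<in> {(i, j, k). 1 \<le> i \<and> i \<le> j \<and> j \<le> k \<and> k \<le> m}.
        (real i + real j + 2) / (real i + real j))"
proof (induction m)
  case 0
  have empty: "{(i, j, k). 1 \<le> i \<and> i \<le> j \<and> j \<le> k \<and> k \<le> (0::nat)} = {}"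
    by auto
  show ?case
    unfolding empty by simp
next
  case (Suc m)
  let ?A = "\<lambda>m. {(i, j, k). 1 \<le> i \<and> i \<le> j \<and> j \<le> k \<and> k \<le> (m::nat)}"
  let ?B = "(\<lambda>(i, j). (i, j, Suc m)) ` {(i, j). 1 \<le> i \<and> i \<le> j \<and> j \<le> Suc m}"
  let ?f = "\<lambda>(i, j, k). (real i + real j + 2) / (real i + real j)"
  have "prod ?f (?A (Suc m)) = prod ?f (?A m) * prod ?f ?B"
  proof (subst prod.union_disjoint[symmetric])
    show "finite (?A m)"
      by (rule finite_subset[of _ "{..m} \<times> {..m} \<times> {..m}"]) auto
    show "finite ?B"
      by (rule finite_imageI, rule finite_subset[of _ "{..Suc m} \<times> {..Suc m}"]) auto
    have "?A (Suc m) = ?A m \<union> ?B"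
      by (auto simp: le_Suc_eq image_iff)
    then show "prod ?f (?A (Suc m)) = prod ?f (?A m \<union> ?B)"
      by (rule arg_cong)
  qed auto
  also have "prod ?f ?B = real (catalan (Suc (Suc m)))"
    unfolding catalan_eq_prod by (subst prod.reindex) (auto simp: inj_on_def intro!: prod.cong)
  also have "prod ?f (?A m) = real (\<Prod>j = 1..Suc m. catalan j)"
    using Suc.IH by simp
  finally show ?case
    by (simp del: catalan.simps)
qed

theorem theorem2p7:
  fixes n :: nat and S1 S2 :: "color set"
  assumes "n \<ge> 1"
    and "S1 \<in> {{Blue, Green}, {Blue, Silver}, {Yellow, Orange}, {Green, Silver}}"
    and "S2 \<in> {{Red, Yellow}, {Red, Green}, {Yellow, Green}, {Blue, Orange}}"
  shows "card (order_ideals (tetra_poset n S1)) = card (order_ideals (tetra_poset n S2))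
    \<and> card (order_ideals (tetra_poset n S2)) = (\<Prod>j = 1..n. catalan j)
    \<and> real (\<Prod>j = 1..n. catalan j) = (\<Prod>j = 1..n. 1 / (real j + 1) * real ((2 * j) choose j))
    \<and> (\<Prod>j = 1..n. 1 / (real j + 1) * real ((2 * j) choose j)) =
        (\<Prod>(i, j, k) \<in> {(i, j, k). 1 \<le> i \<and> i \<le> j \<and> j \<le> k \<and> k \<le> n - 1}.
           (real i + real j + 2) / (real i + real j))
    \<and> ideal_gf (tetra_poset n S1) = ideal_gf ((tetra_poset n S2)\<inverse>)
    \<and> ideal_gf ((tetra_poset n S2)\<inverse>) = (\<Prod>j = 1..n. carlitz_riordan j)"
proof -
  \<comment> \<open>Evaluation at \<open>q = 1\<close> turns generating functions into
    counts.\<close>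
  have cards: "card (closed_subsets (tetra n) R) = (\<Prod>j = 1..n. catalan j)"
    if "closed_gf (tetra n) R = (\<Prod>j = 1..n. carlitz_riordan j)" for R
  proof -
    have "int (card (closed_subsets (tetra n) R)) = poly (\<Prod>j = 1..n. carlitz_riordan j) 1"
      by (simp add: that flip: poly_closed_gf_1)
    also have "\<dots> = int (\<Prod>j = 1..n. catalan j)"
      by (simp add: poly_prod poly_carlitz_riordan_1)
    finally show ?thesis
      by (simp only: of_nat_eq_iff)
  qed
  note gf = closed_gf_tetra_S1[OF assms(2), of n] closed_gf_tetra_S2[OF assms(3), of n]
  have "card (order_ideals (tetra_poset n S1)) = (\<Prod>j = 1..n. catalan j)"
    "card (order_ideals (tetra_poset n S2)) = (\<Prod>j = 1..n. catalan j)"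
    using gf[THEN cards] by (simp_all add: order_ideals_tetra_poset card_closed_subsets_converse)
  moreover have "ideal_gf (tetra_poset n S1) = (\<Prod>j = 1..n. carlitz_riordan j)"
    "ideal_gf ((tetra_poset n S2)\<inverse>) = (\<Prod>j = 1..n. carlitz_riordan j)"
    using gf by (simp_all add: ideal_gf_def closed_gf_def order_ideals_tetra_poset
      order_ideals_tetra_poset_converse)
  moreover have "real (\<Prod>j = 1..n. catalan j) =
      (\<Prod>j = 1..n. 1 / (real j + 1) * real ((2 * j) choose j))"
    by (simp only: of_nat_prod catalan_eq_binomial)
  moreover have "real (\<Prod>j = 1..n. catalan j) =
      (\<Prod>(i, j, k) \<in> {(i, j, k). 1 \<le> i \<and> i \<le> j \<and> j \<le> k \<and> k \<le> n - 1}.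
         (real i + real j + 2) / (real i + real j))"
    \<comment> \<open>The assumption \<open>n \<ge> 1\<close> identifies \<open>Suc (n - 1)\<close>
      with \<open>n\<close>.\<close>
    using prod_catalan_eq_prod[of "n - 1"] assms(1) by (simp del: prod.cl_ivl_Suc)
  ultimately show ?thesis
    by simp
qed

end
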